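(* Let $c\geq 1$ be an integer, let $X$ be an integer of parity opposite to that of $c$, put $N(X,c)=X^2+c$, and let $A$ be an integer dividing $N(X,c)$. Then there exists a unique admissible pair of sequences $(U_n,Z_n)_{n\in\mathbb{Z}}$ (in the sense of the context) such that $U_n^2+c=Z_nZ_{n+1}$ for all $n\in\mathbb{Z}$, $U_0=X$ and $Z_0=A$.
   Context: Fix an integer $c\ge 1$. An admissible pair $(U_n,Z_n)_{n\in\mathbb{Z}}$ consists of a sequence with arithmetic difference $U_n=\alpha n(n-1)+\beta n+U_0$ ($n\in\mathbb{Z}$), where $\alpha\in\mathbb{Z}$, $\beta\in 2\mathbb{Z}$ and $U_0\in 2\mathbb{Z}+(c-1)$ (so all $U_n$ have parity opposite to that of $c$), together with the sequence $Z_n=\frac12(U_n+U_{n-1})$. Equivalently $Z_n=\alpha n(n-1)+\gamma n+Z_0$ with $\gamma=\beta-\alpha$ and $Z_0=\alpha-\frac{\beta}{2}+U_0$. *)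

theory Defs
  imports Main
begin

definition arith_diff_seq :: "int \<Rightarrow> (int \<Rightarrow> int) \<Rightarrow> bool" where
  "arith_diff_seq c U \<longleftrightarrow>
     (\<exists>\<alpha> \<beta>. even \<beta> \<and> (\<forall>n. U n = \<alpha> * n * (n - 1) + \<beta> * n + U 0)) \<and>
     even (U 0 - (c - 1))"

text \<open>The relation \<open>Z n = (U n + U (n - 1)) / 2\<close> is stated without a denominator,
  so that no rounding of integer division is involved.\<close>

definition admissible_pair :: "int \<Rightarrow> (int \<Rightarrow> int) \<Rightarrow> (int \<Rightarrow> int) \<Rightarrow> bool" where
  "admissible_pair c U Z \<longleftrightarrow>
     arith_diff_seq c U \<and> (\<forall>n. 2 * Z n = U n + U (n - 1))"

definition N :: "int \<Rightarrow> int \<Rightarrow> int" where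
  "N X c = X\<^sup>2 + c"

end

theory Submission
  imports Defs
begin

text \<open>Write \<open>N X c = A * B\<close>. The recurrence at \<open>n = 0\<close> forces \<open>Z 1 = B\<close>, and then \<open>Z 0 = A\<close>,
  \<open>Z 1 = B\<close> and \<open>U 0 = X\<close> determine the values of the quadratic sequence \<open>U\<close> at \<open>-1\<close>, \<open>0\<close>, \<open>1\<close>,
  hence its coefficients \<open>\<alpha> = A + B - 2 * X\<close> and \<open>\<beta> = 2 * (B - X)\<close>. Conversely, for these
  coefficients \<open>Z n * Z (n + 1) - (U n)\<^sup>2\<close> is a constant polynomial in \<open>n\<close>, equal to
  \<open>A * B - X\<^sup>2 = c\<close>.\<close>

definition U_seq :: "int \<Rightarrow> int \<Rightarrow> int \<Rightarrow> int \<Rightarrow> int" where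
  "U_seq A B X n = (A + B - 2 * X) * n * (n - 1) + 2 * (B - X) * n + X"

text \<open>Halving is exact: n(n-1) + (n-1)(n-2) = 2(n-1)^2, and the linear coefficient 2(B-X) is
  even.\<close>

definition Z_seq :: "int \<Rightarrow> int \<Rightarrow> int \<Rightarrow> int \<Rightarrow> int" where
  "Z_seq A B X n = (A + B - 2 * X) * (n - 1)\<^sup>2 + (B - X) * (2 * n - 1) + X"

lemma admissible_pair_U_seq_Z_seq:
  assumes "even (X - (c - 1))"
  shows "admissible_pair c (U_seq A B X) (Z_seq A B X)"
proof -
  have "U_seq A B X n = (A + B - 2 * X) * n * (n - 1) + 2 * (B - X) * n + U_seq A B X 0" for n
    by (simp add: U_seq_def)
  moreover have "even (2 * (B - X))" by simp
  moreover have "even (U_seq A B X 0 - (c - 1))"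
    using assms by (simp add: U_seq_def)
  ultimately have "arith_diff_seq c (U_seq A B X)"
    unfolding arith_diff_seq_def
    by (intro conjI exI[of _ "A + B - 2 * X"] exI[of _ "2 * (B - X)"] allI)
  moreover have "2 * Z_seq A B X n = U_seq A B X n + U_seq A B X (n - 1)" for n
    unfolding U_seq_def Z_seq_def by algebra
  ultimately show ?thesis
    unfolding admissible_pair_def by blast
qed

text \<open>With d n = (U n - U (n-1))/2, which is arithmetic of difference \<alpha>, the product
  minus (U n)^2 is \<alpha> U n - d n d (n+1), whose increments vanish.\<close>

lemma U_seq_Z_seq_relation:
  "(U_seq A B X n)\<^sup>2 + (A * B - X\<^sup>2) = Z_seq A B X n * Z_seq A B X (n + 1)"
  unfolding U_seq_def Z_seq_def by algebra

lemma admissible_pair_unique: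
  assumes "admissible_pair c U Z"
  shows "U = U_seq (Z 0) (Z 1) (U 0)" and "Z = Z_seq (Z 0) (Z 1) (U 0)"
proof -
  obtain \<alpha> \<beta> where U: "\<And>n. U n = \<alpha> * n * (n - 1) + \<beta> * n + U 0"
    and Z: "\<And>n. 2 * Z n = U n + U (n - 1)"
    using assms unfolding admissible_pair_def arith_diff_seq_def by blast
  have \<beta>: "\<beta> = 2 * (Z 1 - U 0)"
    using Z[of 1] U[of 1] by simp
  \<comment> \<open>Here U (-1) = 2\<alpha> - \<beta> + U 0.\<close>
  have \<alpha>: "\<alpha> = Z 0 + Z 1 - 2 * U 0"
    using Z[of 0] U[of "-1"] \<beta> by simp
  show U_eq: "U = U_seq (Z 0) (Z 1) (U 0)"
    using U unfolding \<alpha> \<beta> U_seq_def by blast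
  show "Z = Z_seq (Z 0) (Z 1) (U 0)"
  proof
    fix n
    have "2 * Z n = 2 * Z_seq (Z 0) (Z 1) (U 0) n"
      unfolding Z U[of n] U[of "n - 1"] \<alpha> \<beta> Z_seq_def by algebra
    then show "Z n = Z_seq (Z 0) (Z 1) (U 0) n" by simp
  qed
qed

theorem proposition3p1p2:
  fixes c X A :: int
  assumes "c \<ge> 1"
    and "even X \<longleftrightarrow> odd c"
    and "A dvd N X c"
  shows "\<exists>!(UZ :: (int \<Rightarrow> int) \<times> (int \<Rightarrow> int)). case UZ of (U, Z) \<Rightarrow>
           admissible_pair c U Z \<and>
           (\<forall>n. (U n)\<^sup>2 + c = Z n * Z (n + 1)) \<and>
           U 0 = X \<and> Z 0 = A"
proof -
  obtain B where B: "X\<^sup>2 + c = A * B"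
    using assms(3) unfolding N_def by blast
  \<comment> \<open>Positivity gives \<open>A \<noteq> 0\<close>, so \<open>A\<close> can be
    cancelled when the recurrence at 0 is solved for \<open>Z 1\<close>.\<close>
  have "X\<^sup>2 + c > 0"
    using assms(1) by (simp add: add_nonneg_pos)
  with B have "A \<noteq> 0" by auto
  have c: "c = A * B - X\<^sup>2" using B by simp
  have adm: "admissible_pair c (U_seq A B X) (Z_seq A B X)"
    using assms(2) by (intro admissible_pair_U_seq_Z_seq) auto
  have rel: "(U_seq A B X n)\<^sup>2 + c = Z_seq A B X n * Z_seq A B X (n + 1)" for n
    unfolding c by (rule U_seq_Z_seq_relation)
  have init: "U_seq A B X 0 = X" "Z_seq A B X 0 = A"
    by (simp_all add: U_seq_def Z_seq_def)
  have uniq: "U = U_seq A B X \<and> Z = Z_seq A B X"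
    if "admissible_pair c U Z" and UZ: "\<And>n. (U n)\<^sup>2 + c = Z n * Z (n + 1)"
      and "U 0 = X" and "Z 0 = A" for U Z
  proof -
    have "A * Z 1 = A * B"
      using UZ[of 0] unfolding that(3,4) B by (simp add: eq_commute)
    with \<open>A \<noteq> 0\<close> have "Z 1 = B" by simp
    then show ?thesis
      using admissible_pair_unique[OF that(1)] that(3,4) by simp
  qed
  show ?thesis
  proof (rule ex1I[of _ "(U_seq A B X, Z_seq A B X)"], goal_cases)
    case 1
    show ?case using adm rel init by simp
  next
    case (2 UZ)
    then show ?case using uniq[of "fst UZ" "snd UZ"] by (simp add: case_prod_beta prod_eq_iff)
  qed
qed

end
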